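(* Let $C_i(A_i,r_i)$, $i=1,\ldots,n$, be $n$ non-overlapping circles such that $A_1\cdots A_n$ is an $n$-gon in $\mathbb{R}^2$, and let each vertex $A_i$ possess a non-negative weight $w_i$, $i=1,\ldots,n$. Let $P$ be the generalized Fermat-Torricelli point of the weighted circles $C_i(A_i,r_i)$. Assume that the floating case of the generalized Fermat-Torricelli problem is valid: $$\Big\|\sum_{j\ne i} w_j\,\vec u(A_j,A_i)\Big\|>w_i,\qquad i\in\{1,\ldots,n\},$$ and select $r_i$ $(i=1,\ldots,n)$ such that $P$ does not belong to the disk bounded by $C_i(A_i,r_i)$. Assume that $P$ is connected with every vertex $A_i$ for $i=1,\ldots,n$; that, for each $i$, $C_i'$ is a circle with non-negative weight $w_i$, with radius $r_i'$ and with center $A_i'$ on the line defined by the line segment $PA_i$; that the $n$-gon $A_1'\cdots A_n'$ has the property $$\Big\|\sum_{j\ne i} w_j\,\vec u(A_j',A_i')\Big\|>w_i,\qquad i=1,\ldots,n;$$ and that $P$ does not belong to the disk with center $A_i'$ and radius $r_i'$ for $i=1,\ldots,n$. Then the generalized Fermat-Torricelli point $P'$ of the weighted circles $C_1',\ldots,C_n'$ equals $P$ (the geometric plasticity principle).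
   Context: $C_i(A_i,r_i)$ denotes the circle in $\mathbb{R}^2$ with center $A_i$ and radius $r_i$. $\vec u(X,Y)$ is the unit vector in the direction from $X$ to $Y$. The generalized Fermat-Torricelli point of circles $C_1,\ldots,C_n$ with weights $w_1,\ldots,w_n$ is the point $P\in\mathbb{R}^2$ minimizing $\sum_{i=1}^n w_i\,d(P,C_i)$, where $d$ is the Euclidean distance.
   Formalization: Each new center A_i' is required to lie on the half-line from P through A_i, not on the whole line; with the whole line the claim fails, e.g. for an equilateral triangle with unit weights and center P = 0 when A_1 = (0,1) is moved to (0,-2). *)

theory Defs
  imports "HOL-Analysis.Analysis"
begin

type_synonym point = "real ^ 2"

definition unit_vec :: "point \<Rightarrow> point \<Rightarrow> point" where
  "unit_vec X Y = (Y - X) /\<^sub>R norm (Y - X)"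

text \<open>
  Indices are \<open>0, \<dots>, n - 1\<close>, taken cyclically for the edges. The vertices are pairwise distinct
  and two consecutive edges meet only in their common vertex, so the edges cannot backtrack and the
  vertices are not all collinear. Neither convexity nor simplicity is required, and
  a vertex may have a straight angle; every nondegenerate simple polygon is included.
\<close>

definition is_ngon :: "nat \<Rightarrow> (nat \<Rightarrow> point) \<Rightarrow> bool" where
  "is_ngon n A \<longleftrightarrow>
     3 \<le> n \<and> inj_on A {..<n} \<and>
     (\<forall>i<n. closed_segment (A i) (A (Suc i mod n)) \<inter>
            closed_segment (A (Suc i mod n)) (A (Suc (Suc i) mod n)) = {A (Suc i mod n)})"

text \<open>Tangent circles count as non-overlapping, since only the open disks are required to be disjoint.\<close>

definition non_overlapping :: "nat \<Rightarrow> (nat \<Rightarrow> point) \<Rightarrow> (nat \<Rightarrow> real) \<Rightarrow> bool" where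
  "non_overlapping n A r \<longleftrightarrow>
     (\<forall>i<n. \<forall>j<n. i \<noteq> j \<longrightarrow> ball (A i) (r i) \<inter> ball (A j) (r j) = {})"

definition floating_case :: "nat \<Rightarrow> (nat \<Rightarrow> real) \<Rightarrow> (nat \<Rightarrow> point) \<Rightarrow> bool" where
  "floating_case n w A \<longleftrightarrow>
     (\<forall>i<n. norm (\<Sum>j\<in>{..<n} - {i}. w j *\<^sub>R unit_vec (A j) (A i)) > w i)"

definition weighted_dist :: "nat \<Rightarrow> (nat \<Rightarrow> real) \<Rightarrow> (nat \<Rightarrow> point set) \<Rightarrow> point \<Rightarrow> real" where
  "weighted_dist n w C X = (\<Sum>i<n. w i * infdist X (C i))"

text \<open>
  Uniqueness of the minimizer is not part of the definition.
\<close>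

definition is_gen_FT_point :: "nat \<Rightarrow> (nat \<Rightarrow> real) \<Rightarrow> (nat \<Rightarrow> point set) \<Rightarrow> point \<Rightarrow> bool" where
  "is_gen_FT_point n w C P \<longleftrightarrow> (\<forall>X. weighted_dist n w C P \<le> weighted_dist n w C X)"

text \<open>
  The part of the line through \<open>P\<close> and \<open>Q\<close> that starts at \<open>P\<close> and runs through \<open>Q\<close>. The opposite
  half-line is left out: moving a single centre across \<open>P\<close> reverses the corresponding unit vector
  and in general destroys the equilibrium at \<open>P\<close>.
\<close>

definition ray :: "point \<Rightarrow> point \<Rightarrow> point set" where
  "ray P Q = {P + t *\<^sub>R (Q - P) | t. 0 \<le> t}"

end

theory Submission
  imports Defs
begin

text \<open>
  The distance from \<open>X\<close> to the circle with centre \<open>a\<close> and radius \<open>r\<close> is at least \<open>norm (X - a) - r\<close>,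
  with equality outside the disk. So, up to a constant, the objective lies above the convex function
  \<open>\<Sum> w\<^sub>i * norm (X - A\<^sub>i)\<close> and agrees with it near \<open>P\<close>; minimality at \<open>P\<close> therefore forces the
  equilibrium \<open>\<Sum> w\<^sub>i * sgn (P - A\<^sub>i) = 0\<close>. This condition only depends on the directions of the
  centres seen from \<open>P\<close>, hence passes to the new centres, where convexity makes \<open>P\<close> a minimizer. A second
  minimizer would put all centres of positive weight on one line through \<open>P\<close>, and then the
  floating inequality fails at the one closest to \<open>P\<close>.
\<close>

section \<open>Distance from a point to weighted circles\<close>

lemma unit_vec_eq_sgn: "unit_vec X Y = sgn (Y - X)"
  by (simp add: unit_vec_def sgn_div_norm)

text \<open>Triangle inequality through the centre. Inside the disk the left side is negative, but
  the bound must cover competitors \<open>x\<close> lying there as well.\<close>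

lemma infdist_sphere_ge:
  fixes a x :: "'a::euclidean_space"
  assumes "r \<ge> 0"
  shows "norm (x - a) - r \<le> infdist x (sphere a r)"
proof -
  have ne: "sphere a r \<noteq> {}"
    using assms by simp
  have "norm (x - a) - r \<le> dist x y" if "y \<in> sphere a r" for y
    using that dist_triangle[of x a y] by (simp add: dist_norm norm_minus_commute)
  then show ?thesis
    unfolding infdist_notempty[OF ne] by (intro cINF_greatest ne)
qed

lemma infdist_sphere_outside:
  fixes a x :: "'a::euclidean_space"
  assumes "r \<ge> 0" "r \<le> norm (x - a)"
  shows "infdist x (sphere a r) = norm (x - a) - r"
proof (cases "x = a")
  case True
  then show ?thesis using assms by simp
next
  case False
  \<comment> \<open>The radial projection of \<open>x\<close> onto the circle, its nearest point
    there.\<close>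
  let ?y = "a + r *\<^sub>R sgn (x - a)"
  have "?y \<in> sphere a r"
    using assms False by (simp add: dist_norm norm_sgn)
  then have "infdist x (sphere a r) \<le> dist x ?y"
    by (rule infdist_le)
  also have "x - ?y = (norm (x - a) - r) *\<^sub>R sgn (x - a)"
    using False by (simp add: sgn_div_norm algebra_simps)
  then have "dist x ?y = norm (x - a) - r"
    using assms False by (simp add: dist_norm norm_sgn)
  finally show ?thesis
    using infdist_sphere_ge[OF assms(1), of x a] by simp
qed

lemma weighted_dist_spheres_ge:
  assumes "\<And>i. i < n \<Longrightarrow> w i \<ge> 0" "\<And>i. i < n \<Longrightarrow> r i > 0"
  shows "(\<Sum>i<n. w i * norm (X - A i)) - (\<Sum>i<n. w i * r i)
    \<le> weighted_dist n w (\<lambda>i. sphere (A i) (r i)) X"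
  unfolding weighted_dist_def sum_subtractf[symmetric] right_diff_distrib[symmetric]
  using assms by (intro sum_mono mult_left_mono infdist_sphere_ge) (auto simp: less_imp_le)

lemma weighted_dist_spheres_outside:
  assumes "\<And>i. i < n \<Longrightarrow> r i > 0" "\<And>i. i < n \<Longrightarrow> X \<notin> cball (A i) (r i)"
  shows "weighted_dist n w (\<lambda>i. sphere (A i) (r i)) X
    = (\<Sum>i<n. w i * norm (X - A i)) - (\<Sum>i<n. w i * r i)"
  unfolding weighted_dist_def sum_subtractf[symmetric] right_diff_distrib[symmetric]
proof (intro sum.cong refl)
  fix i assume "i \<in> {..<n}"
  then have "r i \<ge> 0" "r i \<le> norm (X - A i)"
    using assms[of i] by (auto simp: dist_norm norm_minus_commute)
  then show "w i * infdist X (sphere (A i) (r i)) = w i * (norm (X - A i) - r i)"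
    by (simp add: infdist_sphere_outside)
qed

section \<open>First-order condition at a minimizer\<close>

lemma equilibrium_of_local_minimum:
  fixes A :: "'i \<Rightarrow> 'a::real_inner"
  assumes "open S" "P \<in> S"
    and "\<And>X. X \<in> S \<Longrightarrow> (\<Sum>i\<in>I. w i * norm (P - A i)) \<le> (\<Sum>i\<in>I. w i * norm (X - A i))"
    and "\<And>i. i \<in> I \<Longrightarrow> P \<noteq> A i"
  shows "(\<Sum>i\<in>I. w i *\<^sub>R sgn (P - A i)) = 0"
proof -
  let ?g = "\<lambda>X. \<Sum>i\<in>I. w i * norm (X - A i)"
  let ?v = "\<Sum>i\<in>I. w i *\<^sub>R sgn (P - A i)"
  have "(?g has_derivative (\<lambda>h. \<Sum>i\<in>I. w i * (h \<bullet> sgn (P - A i)))) (at P)"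
  proof (rule has_derivative_sum)
    fix i assume "i \<in> I"
    then have "P - A i \<noteq> 0"
      using assms(4) by simp
    then show "((\<lambda>X. w i * norm (X - A i)) has_derivative (\<lambda>h. w i * (h \<bullet> sgn (P - A i)))) (at P)"
      by (intro has_derivative_mult_right
          has_derivative_compose[OF _ has_derivative_norm, where f = "\<lambda>X. X - A i" and f' = "\<lambda>h. h"])
        (auto intro!: derivative_eq_intros)
  qed
  then have "(\<lambda>h. \<Sum>i\<in>I. w i * (h \<bullet> sgn (P - A i))) = (\<lambda>h. 0)"
    using assms(1-3) by (intro differential_zero_maxmin[of P S ?g]) auto
  \<comment> \<open>The vanishing derivative is evaluated in the direction \<open>h = ?v\<close> of
    the gradient itself.\<close>
  then have "(\<Sum>i\<in>I. w i * (?v \<bullet> sgn (P - A i))) = 0"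
    by (rule fun_cong)
  then have "?v \<bullet> ?v = 0"
    by (simp add: inner_sum_right[where f = "\<lambda>i. w i *\<^sub>R sgn (P - A i)"])
  then show ?thesis
    by simp
qed

lemma equilibrium_of_gen_FT_point:
  assumes "\<And>i. i < n \<Longrightarrow> r i > 0" "\<And>i. i < n \<Longrightarrow> P \<notin> cball (A i) (r i)"
    and "is_gen_FT_point n w (\<lambda>i. sphere (A i) (r i)) P"
  shows "(\<Sum>i<n. w i *\<^sub>R sgn (P - A i)) = 0"
proof (rule equilibrium_of_local_minimum)
  \<comment> \<open>On this open set the objective differs from the weighted sum of distances to the
    centres only by a constant.\<close>
  let ?S = "\<Inter>i<n. - cball (A i) (r i)"
  show "open ?S"
    by (intro open_INT) auto
  show "P \<in> ?S"
    using assms(2) by blast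
  show "(\<Sum>i<n. w i * norm (P - A i)) \<le> (\<Sum>i<n. w i * norm (X - A i))" if "X \<in> ?S" for X
  proof -
    have "\<And>i. i < n \<Longrightarrow> X \<notin> cball (A i) (r i)"
      using that by blast
    then show ?thesis
      using assms(3)[unfolded is_gen_FT_point_def, rule_format, of X] assms(1,2)
      by (simp add: weighted_dist_spheres_outside)
  qed
  show "P \<noteq> A i" if "i \<in> {..<n}" for i
    using assms(1,2)[of i] that by auto
qed

section \<open>Global minimality and uniqueness from equilibrium\<close>

lemma inner_sgn_self: "sgn x \<bullet> x = norm x" for x :: "'a::real_inner"
  by (cases "x = 0") (auto simp: sgn_div_norm dot_square_norm power2_eq_square)

lemma inner_sgn_le: "sgn x \<bullet> y \<le> norm y" for x y :: "'a::real_inner"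
  using norm_cauchy_schwarz[of "sgn x" y] by (simp add: norm_sgn split: if_splits)

text \<open>The left side is affine in \<open>X\<close> with the equilibrium vector as gradient,
  hence constant. It bounds the convex sum of distances from below when the weights are
  non-negative.\<close>

lemma equilibrium_sum_inner:
  fixes A :: "'i \<Rightarrow> 'a::real_inner"
  assumes "(\<Sum>i\<in>I. w i *\<^sub>R sgn (P - A i)) = 0"
  shows "(\<Sum>i\<in>I. w i * (sgn (P - A i) \<bullet> (X - A i))) = (\<Sum>i\<in>I. w i * norm (P - A i))"
proof -
  have "sgn (P - A i) \<bullet> (X - A i) = sgn (P - A i) \<bullet> (X - P) + norm (P - A i)" for i
    unfolding inner_sgn_self[symmetric] by (simp add: inner_diff_right)
  moreover have "(\<Sum>i\<in>I. w i * (sgn (P - A i) \<bullet> (X - P))) = (\<Sum>i\<in>I. w i *\<^sub>R sgn (P - A i)) \<bullet> (X - P)"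
    by (simp add: inner_sum_left)
  ultimately show ?thesis
    using assms by (simp add: distrib_left sum.distrib)
qed

lemma equilibrium_minimizes:
  fixes A :: "'i \<Rightarrow> 'a::real_inner"
  assumes "(\<Sum>i\<in>I. w i *\<^sub>R sgn (P - A i)) = 0" "\<And>i. i \<in> I \<Longrightarrow> w i \<ge> 0"
  shows "(\<Sum>i\<in>I. w i * norm (P - A i)) \<le> (\<Sum>i\<in>I. w i * norm (X - A i))"
  unfolding equilibrium_sum_inner[OF assms(1), of X, symmetric]
  by (intro sum_mono mult_left_mono inner_sgn_le assms(2))

text \<open>The Cauchy-Schwarz gaps \<open>?d\<close> are non-negative with total at most zero, so
  each vanishes. At positive weight this is the equality case, which aligns \<open>X - A i\<close>
  with \<open>P - A i\<close>.\<close>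

lemma other_minimizer_collinear:
  fixes A :: "'i \<Rightarrow> 'a::real_inner"
  assumes "finite I" "\<And>i. i \<in> I \<Longrightarrow> w i \<ge> 0"
    and eq: "(\<Sum>i\<in>I. w i *\<^sub>R sgn (P - A i)) = 0"
    and le: "(\<Sum>i\<in>I. w i * norm (X - A i)) \<le> (\<Sum>i\<in>I. w i * norm (P - A i))"
    and "X \<noteq> P" "i \<in> I" "w i > 0"
  shows "\<exists>s. A i = P + s *\<^sub>R (X - P)"
proof -
  let ?u = "sgn (P - A i)"
  let ?d = "\<lambda>i. w i * (norm (X - A i) - sgn (P - A i) \<bullet> (X - A i))"
  have nonneg: "?d j \<ge> 0" if "j \<in> I" for j
    using assms(2)[OF that] inner_sgn_le[of "P - A j" "X - A j"] by simp
  have "sum ?d I \<le> 0"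
    using le equilibrium_sum_inner[OF eq, of X] by (simp add: right_diff_distrib sum_subtractf)
  then have "?d i = 0"
    using assms(1,6) nonneg sum_nonneg[of I ?d] sum_nonneg_eq_0_iff[of I ?d] by auto
  then have inner: "?u \<bullet> (X - A i) = norm (X - A i)"
    using assms(7) by simp
  show ?thesis
  proof (cases "P = A i")
    case True
    then show ?thesis by (intro exI[of _ 0]) simp
  next
    case False
    then have "norm ?u = 1"
      by (simp add: norm_sgn)
    then have "X - A i = norm (X - A i) *\<^sub>R ?u"
      using inner norm_cauchy_schwarz_eq[of ?u "X - A i"] by simp
    moreover have P: "P - A i = norm (P - A i) *\<^sub>R ?u"
      using False by (simp add: sgn_div_norm)
    \<comment> \<open>Both \<open>X\<close> and \<open>P\<close> lie on the ray from
      \<open>A i\<close> in direction \<open>?u\<close>; \<open>c\<close> is their signed distance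
      along it.\<close>
    moreover define c where "c = norm (X - A i) - norm (P - A i)"
    ultimately have c: "X - P = c *\<^sub>R ?u"
      by (metis diff_diff_eq2 diff_add_cancel scaleR_left_diff_distrib)
    then have "c \<noteq> 0"
      using assms(5) by auto
    then have "P - A i = (norm (P - A i) / c) *\<^sub>R (X - P)"
      using P unfolding c by simp
    then have "A i = P + (- (norm (P - A i) / c)) *\<^sub>R (X - P)"
      by (simp add: algebra_simps)
    then show ?thesis ..
  qed
qed

text \<open>Moving from \<open>P\<close> to the nearest centre of positive weight passes no other
  such centre, so the unit vectors from the others are unchanged. By equilibrium their weighted sum
  has norm \<open>w i\<close>.\<close>

lemma collinear_equilibrium_not_floating:
  fixes A :: "'i \<Rightarrow> 'a::real_normed_vector"
  assumes "finite I" "inj_on A I" "\<And>i. i \<in> I \<Longrightarrow> w i \<ge> 0"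
    and eq: "(\<Sum>i\<in>I. w i *\<^sub>R sgn (P - A i)) = 0"
    and ne: "\<And>i. i \<in> I \<Longrightarrow> P \<noteq> A i"
    and col: "\<And>i. i \<in> I \<Longrightarrow> w i > 0 \<Longrightarrow> \<exists>s. A i = P + s *\<^sub>R e"
    and pos: "\<exists>i\<in>I. w i > 0"
  shows "\<exists>i\<in>I. norm (\<Sum>j\<in>I - {i}. w j *\<^sub>R sgn (A i - A j)) \<le> w i"
proof -
  define J where "J = {i \<in> I. w i > 0}"
  obtain s where s: "\<And>i. i \<in> J \<Longrightarrow> A i = P + s i *\<^sub>R e"
    using col unfolding J_def by (metis (mono_tags, lifting) mem_Collect_eq)
  have J: "finite J" "J \<noteq> {}"
    using assms(1) pos unfolding J_def by auto
  obtain i where i: "i \<in> J" and least: "\<And>j. j \<in> J \<Longrightarrow> \<bar>s i\<bar> \<le> \<bar>s j\<bar>"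
    using ex_is_arg_min_if_finite[OF J, of "\<lambda>i. \<bar>s i\<bar>"]
    by (auto simp: is_arg_min_linorder)
  have sgn_eq: "w j *\<^sub>R sgn (A i - A j) = w j *\<^sub>R sgn (P - A j)" if j: "j \<in> I - {i}" for j
  proof (cases "w j > 0")
    case False
    then show ?thesis using assms(3)[of j] j by simp
  next
    case True
    then have jJ: "j \<in> J"
      using j by (simp add: J_def)
    have "A i \<noteq> A j"
      using assms(2) i j by (auto simp: J_def inj_on_def)
    then have "s i \<noteq> s j"
      using s i jJ by auto
    moreover have "s j \<noteq> 0"
      using ne[of j] s[OF jJ] j by auto
    \<comment> \<open>In a tie \<open>\<bar>s i\<bar> = \<bar>s j\<bar>\<close> the two centres lie
      on opposite sides of \<open>P\<close>, and \<open>s i - s j\<close> equals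
      \<open>- 2 * s j\<close>.\<close>
    ultimately have "sgn (s i - s j) = sgn (- s j)"
      using least[OF jJ] by (auto simp: sgn_if abs_if split: if_splits)
    moreover have "A i - A j = (s i - s j) *\<^sub>R e" "P - A j = (- s j) *\<^sub>R e"
      using s[OF i] s[OF jJ] by (auto simp: algebra_simps)
    ultimately show ?thesis
      by (simp only: sgn_scaleR)
  qed
  have iI: "i \<in> I" "w i > 0"
    using i by (auto simp: J_def)
  have "(\<Sum>j\<in>I - {i}. w j *\<^sub>R sgn (A i - A j)) = (\<Sum>j\<in>I - {i}. w j *\<^sub>R sgn (P - A j))"
    using sgn_eq by (rule sum.cong[OF refl])
  also have "\<dots> = - (w i *\<^sub>R sgn (P - A i))"
    using eq sum.remove[OF assms(1) iI(1), of "\<lambda>j. w j *\<^sub>R sgn (P - A j)"]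
    by (simp add: eq_neg_iff_add_eq_0 add.commute)
  finally have "norm (\<Sum>j\<in>I - {i}. w j *\<^sub>R sgn (A i - A j)) = w i"
    using iI ne[of i] by (simp add: norm_sgn)
  then show ?thesis
    using iI(1) by (metis order_refl)
qed

text \<open>With all weights zero the floating inequality would read 0 > 0.\<close>

lemma floating_case_pos_weight:
  assumes "floating_case n w A" "n > 0" "\<And>i. i < n \<Longrightarrow> w i \<ge> 0"
  shows "\<exists>i<n. w i > 0"
proof (rule ccontr)
  assume "\<not> ?thesis"
  then have "w i = 0" if "i < n" for i
    using assms(3) that by force
  then show False
    using assms(1,2) by (auto simp: floating_case_def)
qed

text \<open>The scaling factor \<open>t\<close> is positive on the ray away from \<open>P\<close>; a
  negative one would reverse the direction. This is what carries the equilibrium over to the moved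
  centres.\<close>

lemma sgn_diff_ray:
  assumes "B \<in> ray P Q" "B \<noteq> P"
  shows "sgn (P - B) = sgn (P - Q)"
proof -
  obtain t where t: "B = P + t *\<^sub>R (Q - P)" "t \<ge> 0"
    using assms(1) by (auto simp: ray_def)
  moreover have "t \<noteq> 0"
    using assms(2) t by auto
  moreover have "P - B = t *\<^sub>R (P - Q)"
    using t by (simp add: algebra_simps)
  ultimately show ?thesis
    by (simp add: sgn_scaleR)
qed

theorem theorem5:
  fixes n :: nat
    and A A' :: "nat \<Rightarrow> real ^ 2"
    and r r' w :: "nat \<Rightarrow> real"
    and P P' :: "real ^ 2"
  assumes "is_ngon n A"
    and "\<And>i. i < n \<Longrightarrow> r i > 0"
    and "non_overlapping n A r"
    and "\<And>i. i < n \<Longrightarrow> w i \<ge> 0"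
    and "is_gen_FT_point n w (\<lambda>i. sphere (A i) (r i)) P"
    and "floating_case n w A"
    and "\<And>i. i < n \<Longrightarrow> P \<notin> cball (A i) (r i)"
    and "\<And>i. i < n \<Longrightarrow> r' i > 0"
    and "\<And>i. i < n \<Longrightarrow> A' i \<in> ray P (A i)"
    and "is_ngon n A'"
    and "floating_case n w A'"
    and "\<And>i. i < n \<Longrightarrow> P \<notin> cball (A' i) (r' i)"
  shows "is_gen_FT_point n w (\<lambda>i. sphere (A' i) (r' i)) P' \<longleftrightarrow> P' = P"
proof -
  have ne: "P \<noteq> A' i" if "i < n" for i
    using assms(8,12)[OF that] by auto
  have "(\<Sum>i<n. w i *\<^sub>R sgn (P - A i)) = 0"
    using equilibrium_of_gen_FT_point assms(2,5,7) by blast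
  moreover have "sgn (P - A' i) = sgn (P - A i)" if "i < n" for i
    using sgn_diff_ray assms(9) ne that by metis
  ultimately have eq: "(\<Sum>i<n. w i *\<^sub>R sgn (P - A' i)) = 0"
    by simp
  let ?F = "weighted_dist n w (\<lambda>i. sphere (A' i) (r' i))"
  let ?g = "\<lambda>X. \<Sum>i<n. w i * norm (X - A' i)"
  \<comment> \<open>The shifted \<open>?g\<close> lies below \<open>?F\<close> everywhere and
    touches it at \<open>P\<close>. Hence minimality of \<open>P\<close> passes from
    \<open>?g\<close> to \<open>?F\<close>, and a competitor at least as good as \<open>P\<close>
    for \<open>?F\<close> is so for \<open>?g\<close>.\<close>
  have F_ge: "?g X - (\<Sum>i<n. w i * r' i) \<le> ?F X" for X
    using assms(4,8) by (rule weighted_dist_spheres_ge)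
  have F_P: "?F P = ?g P - (\<Sum>i<n. w i * r' i)"
    using assms(8,12) by (rule weighted_dist_spheres_outside)
  show ?thesis
  proof
    assume "P' = P"
    have g_min: "?g P \<le> ?g X" for X
      using eq assms(4) by (intro equilibrium_minimizes) auto
    have "?F P \<le> ?F X" for X
      using F_ge[of X] F_P g_min[of X] by linarith
    with \<open>P' = P\<close> show "is_gen_FT_point n w (\<lambda>i. sphere (A' i) (r' i)) P'"
      by (simp add: is_gen_FT_point_def)
  next
    assume "is_gen_FT_point n w (\<lambda>i. sphere (A' i) (r' i)) P'"
    then have "?F P' \<le> ?F P"
      by (simp add: is_gen_FT_point_def)
    then have le: "?g P' \<le> ?g P"
      using F_ge[of P'] F_P by linarith
    show "P' = P"
    proof (rule ccontr)
      assume "P' \<noteq> P"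
      then have "\<exists>s. A' i = P + s *\<^sub>R (P' - P)" if "i \<in> {..<n}" "w i > 0" for i
        using other_minimizer_collinear[OF _ _ eq le _ that] assms(4) by auto
      moreover have "inj_on A' {..<n}" "n > 0"
        using assms(10) by (auto simp: is_ngon_def)
      moreover have "\<exists>i\<in>{..<n}. w i > 0"
        using floating_case_pos_weight[OF assms(11) \<open>n > 0\<close> assms(4)] by auto
      ultimately have "\<exists>i\<in>{..<n}. norm (\<Sum>j\<in>{..<n} - {i}. w j *\<^sub>R sgn (A' i - A' j)) \<le> w i"
        using assms(4) eq ne by (intro collinear_equilibrium_not_floating) auto
      then show False
        using assms(11) by (auto simp: floating_case_def unit_vec_eq_sgn not_less[symmetric])
    qed
  qed
qed

end
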